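(* For integers $m,n\ge 0$, let $t_1(m,n)$ be the number of bicolored (red and blue) partitions of $n$ into exactly $m$ parts satisfying: (1) neither blue parts nor red parts repeat; (2) going through the parts from smallest to largest, for each red part $b$ there is a blue part $b$ or a blue part $b+1$, and these blue parts are distinct for distinct red parts. Let $t_2(m,n)$ be the number of partitions counted by $t_1(m,n)$ in which a red $1$ and a blue $1$ do not both appear. Then, as formal power series in $x$ and $q$, $$\sum_{m,n\ge 0} t_1(m,n)\,x^m q^n=\sum_{m,n\ge 0}\frac{q^{2\binom{m+1}{2}+\binom{n+1}{2}+mn}\,x^{2m+n}}{(q;q)_m\,(q;q)_n},$$ $$\sum_{m,n\ge 0} t_2(m,n)\,x^m q^n=\sum_{m,n\ge 0}\frac{q^{2\binom{m+1}{2}+\binom{n+1}{2}+mn+m}\,x^{2m+n}}{(q;q)_m\,(q;q)_n}.$$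
   Context: For $k\ge 0$, $(a;q)_k=\prod_{j=1}^{k}(1-aq^{j-1})$. A bicolored partition is a partition each of whose parts is colored red or blue; a red part and a blue part of the same size are different parts. The empty partition is the unique partition of $0$, with $0$ parts. *)

theory Defs
  imports "HOL-Analysis.Analysis" "HOL-Library.Multiset"
begin

definition qpoch :: "'a::comm_ring_1 \<Rightarrow> 'a \<Rightarrow> nat \<Rightarrow> 'a" where
  "qpoch a q k = (\<Prod>j=1..k. 1 - a * q ^ (j - 1))"

datatype color = Red | Blue

definition bicolored_partitions :: "nat \<Rightarrow> nat \<Rightarrow> (nat \<times> color) multiset set" where
  "bicolored_partitions m n =
     {P. (\<forall>p \<in># P. 0 < fst p) \<and> size P = m \<and> (\<Sum>p\<in>#P. fst p) = n}"

definition parts_of_color :: "color \<Rightarrow> (nat \<times> color) multiset \<Rightarrow> nat set" where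
  "parts_of_color c P = {b. (b, c) \<in># P}"

definition no_repeated_parts :: "(nat \<times> color) multiset \<Rightarrow> bool" where
  "no_repeated_parts P \<longleftrightarrow> (\<forall>p. count P p \<le> 1)"

definition red_parts_matched :: "(nat \<times> color) multiset \<Rightarrow> bool" where
  "red_parts_matched P \<longleftrightarrow>
     (\<exists>f. inj_on f (parts_of_color Red P) \<and>
          (\<forall>b \<in> parts_of_color Red P. (f b = b \<or> f b = b + 1) \<and> f b \<in> parts_of_color Blue P))"

definition T1 :: "nat \<Rightarrow> nat \<Rightarrow> (nat \<times> color) multiset set" where
  "T1 m n = {P \<in> bicolored_partitions m n. no_repeated_parts P \<and> red_parts_matched P}"

definition T2 :: "nat \<Rightarrow> nat \<Rightarrow> (nat \<times> color) multiset set" where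
  "T2 m n = {P \<in> T1 m n. \<not> ((1, Red) \<in># P \<and> (1, Blue) \<in># P)}"

definition t1 :: "nat \<Rightarrow> nat \<Rightarrow> nat" where
  "t1 m n = card (T1 m n)"

definition t2 :: "nat \<Rightarrow> nat \<Rightarrow> nat" where
  "t2 m n = card (T2 m n)"

text \<open>
  Formal power series in \<open>x\<close> and \<open>q\<close> are elements of \<^typ>\<open>rat fps fps\<close>, the outer variable
  being \<open>x\<close> and the inner one \<open>q\<close>. The library topology on this type is the \<open>x\<close>-adic one, with
  discrete coefficients; it is finer than coefficientwise convergence in both variables.
\<close>

definition gen_fun :: "(nat \<Rightarrow> nat \<Rightarrow> nat) \<Rightarrow> rat fps fps" where
  "gen_fun t = Abs_fps (\<lambda>m. Abs_fps (\<lambda>n. of_nat (t m n)))"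

lemma finite_bicolored_partitions: "finite (bicolored_partitions m n)"
proof (rule finite_subset)
  show "finite (multisets_of_size ({..n} \<times> {Red, Blue}) m)"
    by (intro finite_multisets_of_size) simp
  show "bicolored_partitions m n \<subseteq> multisets_of_size ({..n} \<times> {Red, Blue}) m"
  proof
    fix P assume P: "P \<in> bicolored_partitions m n"
    have "p \<in> {..n} \<times> {Red, Blue}" if p: "p \<in># P" for p
    proof -
      obtain Q where Q: "P = add_mset p Q" using multi_member_split[OF p] by blast
      have "(\<Sum>p\<in>#P. fst p) = n" using P by (simp add: bicolored_partitions_def)
      then have "fst p \<le> n" unfolding Q by simp
      then show ?thesis by (cases p; cases "snd p") simp_all
    qed
    then have "set_mset P \<subseteq> {..n} \<times> {Red, Blue}" by blast
    moreover have "size P = m" using P by (simp add: bicolored_partitions_def)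
    ultimately show "P \<in> multisets_of_size ({..n} \<times> {Red, Blue}) m"
      by (simp add: multisets_of_size_def)
  qed
qed

end

theory Submission
  imports Defs
begin

text \<open>
  Encode a partition without repeated parts as a pair \<open>(R, B)\<close> of finite sets of positive numbers.
  Removing the parts of size 1 and lowering the others by 1 relates the series \<open>A(x)\<close> of the matched
  pairs, the series \<open>E(x)\<close> of those not containing 1 in both colors, and the series \<open>D(x)\<close> of the pairs
  in which a blue 1 is present but already used up by a red part 0:
  \<open>E(x) = (1 + xq) A(xq) + xq D(xq)\<close>, \<open>A(x) = E(x) + x\<^sup>2 q\<^sup>2 A(xq)\<close>,
  \<open>D(x) = xq A(xq) + x\<^sup>2 q\<^sup>2 D(xq)\<close>.
  Let \<open>G(a, b)\<close> be the double series with an additional exponent \<open>a m + b n\<close> of \<open>q\<close>.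
  Splitting off a factor \<open>1 - q ^ m\<close> or \<open>1 - q ^ n\<close> from the denominators gives
  \<open>G(a, b) = G(a + 1, b) + x\<^sup>2 q ^ (a + 2) G(a + 2, b + 1)\<close> and
  \<open>G(a, b) = G(a, b + 1) + x q ^ (b + 1) G(a + 1, b + 1)\<close>, while replacing \<open>x\<close> by \<open>xq\<close> turns
  \<open>G(a, b)\<close> into \<open>G(a + 2, b + 1)\<close>. Hence \<open>A = G(0, 0)\<close>, \<open>D = xq G(1, 1)\<close>, \<open>E = G(1, 0)\<close> solve the
  system, whose solution is unique.
\<close>

section \<open>The double series\<close>

text \<open>An opaque copy of \<open>fps_X\<close>: the default simp rules rewrite powers of \<open>fps_X\<close> to monomials.\<close>

definition q :: "rat fps" where "q = fps_X"

lemma q_nth_0 [simp]: "fps_nth q 0 = 0"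
  by (simp add: q_def)

lemma qpoch_Suc: "qpoch a x (Suc k) = qpoch a x k * (1 - a * x ^ k)"
  by (simp add: qpoch_def)

lemma qpoch_nth_0: "fps_nth (qpoch q q k) 0 = 1"
  by (induction k) (simp_all add: qpoch_Suc qpoch_def)

definition dterm :: "nat \<Rightarrow> nat \<Rightarrow> nat \<Rightarrow> nat \<Rightarrow> rat fps" where
  "dterm a b m n = q ^ (2 * ((m + 1) choose 2) + ((n + 1) choose 2) + m * n + a * m + b * n)
     / (qpoch q q m * qpoch q q n)"

text \<open>The denominator has constant term 1 and is a unit, so the quotient becomes a product of
  inverses that each involve only one index.\<close>

lemma dterm_altdef:
  "dterm a b m n = q ^ (2 * ((m + 1) choose 2) + ((n + 1) choose 2) + m * n + a * m + b * n)
     * (inverse (qpoch q q m) * inverse (qpoch q q n))"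
  by (simp add: dterm_def fps_divide_unit qpoch_nth_0 fps_inverse_mult)

lemma inverse_qpoch_Suc:
  "inverse (qpoch q q (Suc m)) * (1 - q ^ Suc m) = inverse (qpoch q q m)"
proof -
  have "inverse (1 - q * q ^ m) * (1 - q * q ^ m) = 1"
    by (rule inverse_mult_eq_1) simp
  then show ?thesis
    by (simp add: qpoch_Suc fps_inverse_mult mult.assoc)
qed

lemma Suc_choose_2: "(Suc m + 1) choose 2 = ((m + 1) choose 2) + (m + 1)"
  by (simp add: numeral_2_eq_2)

text \<open>Raising \<open>a\<close> by 1 multiplies the term by \<open>q ^ Suc m\<close>. The
  difference therefore has a factor \<open>1 - q ^ Suc m\<close>, which cancels the last factor of
  \<open>qpoch q q (Suc m)\<close>.\<close>

lemma dterm_Suc_left: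
  "dterm a b (Suc m) n = dterm (a + 1) b (Suc m) n + q ^ (a + 2) * dterm (a + 2) (b + 1) m n"
proof -
  define e where "e = 2 * ((Suc m + 1) choose 2) + ((n + 1) choose 2) + Suc m * n + a * Suc m + b * n"
  have e1: "e = (a + 2) + (2 * ((m + 1) choose 2) + ((n + 1) choose 2) + m * n + (a + 2) * m + (b + 1) * n)"
    unfolding e_def Suc_choose_2 by (simp add: algebra_simps)
  have e2: "2 * ((Suc m + 1) choose 2) + ((n + 1) choose 2) + Suc m * n + (a + 1) * Suc m + b * n = e + Suc m"
    unfolding e_def by (simp add: algebra_simps)
  have "dterm a b (Suc m) n - dterm (a + 1) b (Suc m) n
      = q ^ e * (inverse (qpoch q q (Suc m)) * (1 - q ^ Suc m)) * inverse (qpoch q q n)"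
    unfolding dterm_altdef e2 e_def[symmetric] by (simp add: algebra_simps power_add)
  also have "\<dots> = q ^ (a + 2) * dterm (a + 2) (b + 1) m n"
    unfolding inverse_qpoch_Suc dterm_altdef e1 power_add[of q "a + 2"] by (simp only: mult.assoc)
  finally show ?thesis by (simp add: algebra_simps)
qed

text \<open>The same cancellation in the other index: raising \<open>b\<close> by 1 multiplies the
  term by \<open>q ^ Suc n\<close>.\<close>

lemma dterm_Suc_right:
  "dterm a b m (Suc n) = dterm a (b + 1) m (Suc n) + q ^ (b + 1) * dterm (a + 1) (b + 1) m n"
proof -
  define e where "e = 2 * ((m + 1) choose 2) + ((Suc n + 1) choose 2) + m * Suc n + a * m + b * Suc n"
  have e1: "e = (b + 1) + (2 * ((m + 1) choose 2) + ((n + 1) choose 2) + m * n + (a + 1) * m + (b + 1) * n)"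
    unfolding e_def Suc_choose_2 by (simp add: algebra_simps)
  have e2: "2 * ((m + 1) choose 2) + ((Suc n + 1) choose 2) + m * Suc n + a * m + (b + 1) * Suc n = e + Suc n"
    unfolding e_def by (simp add: algebra_simps)
  have "dterm a b m (Suc n) - dterm a (b + 1) m (Suc n)
      = q ^ e * (inverse (qpoch q q (Suc n)) * (1 - q ^ Suc n)) * inverse (qpoch q q m)"
    unfolding dterm_altdef e2 e_def[symmetric] by (simp add: algebra_simps power_add)
  also have "\<dots> = q ^ (b + 1) * dterm (a + 1) (b + 1) m n"
    unfolding inverse_qpoch_Suc dterm_altdef e1 power_add[of q "b + 1"]
    by (simp only: mult_ac)
  finally show ?thesis by (simp add: algebra_simps)
qed

text \<open>Handles the boundary \<open>m = 0\<close>, which \<open>dterm_Suc_left\<close> does not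
  reach.\<close>

lemma dterm_0_left: "dterm a b 0 n = dterm 0 b 0 n"
  by (simp add: dterm_def)

lemma dterm_0_right: "dterm a b m 0 = dterm a 0 m 0"
  by (simp add: dterm_def)

text \<open>The added exponent \<open>2 * m + n\<close> of \<open>q\<close> is the exponent of
  \<open>x\<close> in the same term, so this is the substitution of \<open>xq\<close> for
  \<open>x\<close>.\<close>

lemma dterm_dilate: "dterm (a + 2) (b + 1) m n = q ^ (2 * m + n) * dterm a b m n"
  unfolding dterm_altdef by (simp add: algebra_simps power_add)

section \<open>The coefficient of \<open>x ^ k\<close> in \<open>G(a, b)\<close> and its
  recurrences\<close>

definition dcoeff :: "nat \<Rightarrow> nat \<Rightarrow> nat \<Rightarrow> rat fps" where
  "dcoeff a b k = (\<Sum>(m, n) | 2 * m + n = k. dterm a b m n)"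

lemma finite_exponents: "finite {(m, n). 2 * m + n = (k::nat)}"
  by (rule finite_subset[of _ "{..k} \<times> {..k}"]) auto

lemma dcoeff_0: "dcoeff a b 0 = 1"
proof -
  have "{(m, n). 2 * m + n = (0::nat)} = {(0, 0)}" by auto
  then show ?thesis
    by (simp add: dcoeff_def dterm_def qpoch_def numeral_2_eq_2)
qed

lemma dcoeff_dilate: "dcoeff (a + 2) (b + 1) k = q ^ k * dcoeff a b k"
  unfolding dcoeff_def sum_distrib_left dterm_dilate by (rule sum.cong) auto

text \<open>Apart from the pair with \<open>m = 0\<close>, the index pairs for \<open>k + 2\<close>
  are those for \<open>k\<close> with \<open>m\<close> raised by 1.\<close>

lemma sum_exponents_left:
  fixes f :: "nat \<Rightarrow> nat \<Rightarrow> 'a::comm_monoid_add"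
  shows "(\<Sum>(m, n) | 2 * m + n = k + 2. f m n)
    = f 0 (k + 2) + (\<Sum>(m, n) | 2 * m + n = k. f (Suc m) n)"
proof -
  have eq: "{(m, n). 2 * m + n = k + 2}
      = insert (0, k + 2) (map_prod Suc id ` {(m, n). 2 * m + n = k})" (is "?L = insert _ ?R")
  proof (intro equalityI subsetI)
    fix p assume "p \<in> ?L"
    then show "p \<in> insert (0, k + 2) ?R"
      by (cases p; cases "fst p") (auto simp: image_iff)
  qed auto
  have "inj_on (map_prod Suc id) {(m, n :: nat). 2 * m + n = k}"
    by (rule inj_on_subset[OF prod.inj_map]) simp_all
  then show ?thesis
    unfolding eq by (subst sum.insert)
      (auto simp: finite_exponents finite_exponents[unfolded case_prod_unfold] sum.reindex case_prod_unfold intro!: sum.cong)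
qed

text \<open>Here \<open>n\<close> is raised by 1. The boundary \<open>n = 0\<close> stays a sum
  because it contains a pair only if \<open>k + 1\<close> is even.\<close>

lemma sum_exponents_right:
  fixes f :: "nat \<Rightarrow> nat \<Rightarrow> 'a::comm_monoid_add"
  shows "(\<Sum>(m, n) | 2 * m + n = k + 1. f m n)
    = (\<Sum>(m, n) | 2 * m + n = k + 1 \<and> n = 0. f m n) + (\<Sum>(m, n) | 2 * m + n = k. f m (Suc n))"
proof -
  have eq: "{(m, n). 2 * m + n = k + 1} = {(m, n). 2 * m + n = k + 1 \<and> n = 0}
      \<union> map_prod id Suc ` {(m, n). 2 * m + n = k}" (is "?L = ?Z \<union> ?R")
  proof (intro equalityI subsetI)
    fix p assume "p \<in> ?L"
    then show "p \<in> ?Z \<union> ?R"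
      by (cases p; cases "snd p") (auto simp: image_iff)
  qed auto
  have "inj_on (map_prod id Suc) {(m :: nat, n). 2 * m + n = k}"
    by (rule inj_on_subset[OF prod.inj_map]) simp_all
  moreover have "finite ?Z"
    by (rule finite_subset[OF _ finite_exponents[of "k + 1"]]) auto
  ultimately show ?thesis
    unfolding eq by (subst sum.union_disjoint)
      (auto simp: finite_exponents finite_exponents[unfolded case_prod_unfold] sum.reindex case_prod_unfold intro!: sum.cong)
qed

text \<open>Termwise \<open>dterm_Suc_left\<close>; the boundary terms \<open>m = 0\<close> do not
  depend on \<open>a\<close> and agree on both sides.\<close>

lemma dcoeff_left:
  "dcoeff a b (k + 2) = dcoeff (a + 1) b (k + 2) + q ^ (a + 2) * dcoeff (a + 2) (b + 1) k"
proof -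
  have "(\<Sum>(m, n) | 2 * m + n = k. dterm a b (Suc m) n)
      = (\<Sum>(m, n) | 2 * m + n = k. dterm (a + 1) b (Suc m) n) + q ^ (a + 2) * dcoeff (a + 2) (b + 1) k"
    unfolding dcoeff_def sum_distrib_left sum.distrib[symmetric]
    by (intro sum.cong refl) (auto simp: dterm_Suc_left[of a b])
  then show ?thesis
    unfolding dcoeff_def[of _ _ "k + 2"] sum_exponents_left
    using dterm_0_left[of a b] dterm_0_left[of "a + 1" b] by simp
qed

text \<open>Termwise \<open>dterm_Suc_right\<close>; the boundary terms \<open>n = 0\<close> do not
  depend on \<open>b\<close>.\<close>

lemma dcoeff_right:
  "dcoeff a b (k + 1) = dcoeff a (b + 1) (k + 1) + q ^ (b + 1) * dcoeff (a + 1) (b + 1) k"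
proof -
  have "(\<Sum>(m, n) | 2 * m + n = k. dterm a b m (Suc n))
      = (\<Sum>(m, n) | 2 * m + n = k. dterm a (b + 1) m (Suc n)) + q ^ (b + 1) * dcoeff (a + 1) (b + 1) k"
    unfolding dcoeff_def sum_distrib_left sum.distrib[symmetric]
    by (intro sum.cong refl) (auto simp: dterm_Suc_right[of a b])
  moreover have "(\<Sum>(m, n) | 2 * m + n = k + 1 \<and> n = 0. dterm a b m n)
      = (\<Sum>(m, n) | 2 * m + n = k + 1 \<and> n = 0. dterm a (b + 1) m n)"
    using dterm_0_right[of a b] dterm_0_right[of a "b + 1"] by (intro sum.cong) auto
  ultimately show ?thesis
    unfolding dcoeff_def[of _ _ "k + 1"] sum_exponents_right by simp
qed

text \<open>Only the pair \<open>(0, 1)\<close> contributes, and there \<open>a\<close> is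
  multiplied by 0.\<close>

lemma dcoeff_1: "dcoeff a b 1 = dcoeff 0 b 1"
proof -
  have "{(m, n). 2 * m + n = (1::nat)} = {(0, 1)}" by (auto; presburger)
  then show ?thesis
    by (simp add: dcoeff_def dterm_def)
qed

text \<open>Degree 1 of the equation for \<open>E\<close>; there is no contribution of
  \<open>D\<close>, which is divisible by \<open>x\<close>.\<close>

lemma dcoeff_1_0_1: "dcoeff 1 0 1 = q * (dcoeff 0 0 1 + dcoeff 0 0 0)"
  using dcoeff_right[of 1 0 0] dcoeff_dilate[of 0 0 1] dcoeff_1[of 1 1] dcoeff_1[of 2 1]
  by (simp add: dcoeff_0 algebra_simps numeral_2_eq_2)

text \<open>The equation for \<open>E\<close>, from \<open>G(1, 0) = G(1, 1) + xq G(2, 1)\<close>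
  and \<open>G(1, 1) = G(2, 1) + x^2 q^3 G(3, 2)\<close>, where \<open>G(2, 1)\<close> and
  \<open>G(3, 2)\<close> are \<open>G(0, 0)\<close> and \<open>G(1, 1)\<close> at
  \<open>xq\<close>.\<close>

lemma dcoeff_1_0:
  "dcoeff 1 0 (k + 2) = q ^ (k + 2) * (dcoeff 0 0 (k + 2) + dcoeff 0 0 (k + 1) + q * dcoeff 1 1 k)"
proof -
  have "dcoeff 1 0 (k + 2) = dcoeff 1 1 (k + 2) + q * dcoeff 2 1 (k + 1)"
    using dcoeff_right[of 1 0 "k + 1"] by (simp add: numeral_2_eq_2)
  moreover have "dcoeff 1 1 (k + 2) = dcoeff 2 1 (k + 2) + q ^ 3 * dcoeff 3 2 k"
    using dcoeff_left[of 1 1 k] by (simp add: numeral_2_eq_2 numeral_3_eq_3)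
  ultimately show ?thesis
    using dcoeff_dilate[of 0 0 "k + 1"] dcoeff_dilate[of 0 0 "k + 2"] dcoeff_dilate[of 1 1 k]
    by (simp add: algebra_simps numeral_2_eq_2 numeral_3_eq_3)
qed

text \<open>The equation for \<open>A\<close>.\<close>

lemma dcoeff_0_0: "dcoeff 0 0 (k + 2) = dcoeff 1 0 (k + 2) + q ^ (k + 2) * dcoeff 0 0 k"
  using dcoeff_left[of 0 0 k] dcoeff_dilate[of 0 0 k]
  by (simp add: algebra_simps power_add)

text \<open>The equation for \<open>D\<close>, divided by \<open>xq\<close>.\<close>

lemma dcoeff_1_1: "dcoeff 1 1 (k + 2) = q ^ (k + 2) * (dcoeff 0 0 (k + 2) + q * dcoeff 1 1 k)"
  using dcoeff_left[of 1 1 k] dcoeff_dilate[of 0 0 "k + 2"] dcoeff_dilate[of 1 1 k]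
  by (simp add: algebra_simps power_add numeral_2_eq_2 numeral_3_eq_3)

lemma dcoeff_1_1_1: "dcoeff 1 1 1 = q * dcoeff 0 0 1"
  using dcoeff_dilate[of 0 0 1] dcoeff_1[of 1 1] dcoeff_1[of 2 1] by (simp add: numeral_2_eq_2)

text \<open>The factor \<open>1 - q ^ k\<close> is cancellable, so the recurrences determine the sequences.\<close>

lemma recurrence_unique:
  fixes a d :: "nat \<Rightarrow> rat fps"
  assumes "a 0 = 1" "d 0 = 0"
    and a1: "a 1 = q * (a 1 + a 0 + d 0)"
    and a2: "\<And>k. a (k + 2) = q ^ (k + 2) * (a (k + 2) + a (k + 1) + a k + d (k + 1))"
    and d1: "d 1 = q * a 0"
    and d2: "\<And>k. d (k + 2) = q ^ (k + 2) * (a (k + 1) + d k)"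
  shows "a k = dcoeff 0 0 k \<and> d (k + 1) = q * dcoeff 1 1 k"
proof -
  have cancel: "x = y" if "0 < k" and x: "x = q ^ k * (x + z)" and y: "y = q ^ k * (y + z)"
    for x y z :: "rat fps" and k
  proof -
    have "(1 - q ^ k) * (x - y) = (x - q ^ k * (x + z)) - (y - q ^ k * (y + z))"
      by (simp add: algebra_simps)
    also have "x - q ^ k * (x + z) = 0" by (subst right_minus_eq) (rule x)
    also have "y - q ^ k * (y + z) = 0" by (subst right_minus_eq) (rule y)
    finally have "(1 - q ^ k) * (x - y) = 0" by simp
    moreover have "fps_nth (1 - q ^ k) 0 \<noteq> 0" using \<open>0 < k\<close> by (cases k) simp_all
    then have "1 - q ^ k \<noteq> 0" by (metis fps_zero_nth)
    ultimately show ?thesis by simp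
  qed
  \<comment> \<open>The index of \<open>d\<close> runs one ahead because
    \<open>D = xq G(1, 1)\<close>; this is harmless, as \<open>d (k + 1)\<close> is computed from
    \<open>a k\<close> and \<open>d (k - 1)\<close>.\<close>
  show ?thesis
  proof (induction k rule: less_induct)
    case (less k)
    consider "k = 0" | "k = 1" | j where "k = j + 2"
      by (metis One_nat_def add_2_eq_Suc' not0_implies_Suc)
    then show ?case
    proof cases
      case 1
      then show ?thesis using assms(1) d1 by (simp add: dcoeff_0)
    next
      case 2
      have "a 1 = dcoeff 0 0 1"
      proof (rule cancel)
        show "a 1 = q ^ 1 * (a 1 + 1)"
          unfolding power_one_right using a1[unfolded assms(1,2) add_0_right] .
        show "dcoeff 0 0 1 = q ^ 1 * (dcoeff 0 0 1 + 1)"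
          unfolding power_one_right using dcoeff_1_0_1[unfolded dcoeff_1[of 1 0] dcoeff_0] .
      qed simp
      then show ?thesis
        using 2 d2[of 0] assms(2) dcoeff_1_1_1 by (simp add: numeral_2_eq_2)
    next
      case 3
      have IH: "a (j + 1) = dcoeff 0 0 (j + 1)" "a j = dcoeff 0 0 j"
        "d (j + 2) = q * dcoeff 1 1 (j + 1)" "d (j + 1) = q * dcoeff 1 1 j"
        using less[of j] less[of "j + 1"] 3 by (simp_all add: numeral_2_eq_2)
      \<comment> \<open>By the induction hypothesis both sides solve
        \<open>x = q ^ (j + 2) * (x + z)\<close> with the same \<open>z\<close>.\<close>
      have "a (j + 2) = dcoeff 0 0 (j + 2)"
      proof (rule cancel)
        show "a (j + 2) = q ^ (j + 2) * (a (j + 2) + (a (j + 1) + a j + d (j + 1)))"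
          by (rule trans[OF a2]) (simp add: algebra_simps)
        show "dcoeff 0 0 (j + 2) = q ^ (j + 2) * (dcoeff 0 0 (j + 2) + (a (j + 1) + a j + d (j + 1)))"
          unfolding IH by (rule trans[OF dcoeff_0_0]) (simp only: dcoeff_1_0 algebra_simps)
      qed simp
      moreover have "d (j + 2 + 1) = q ^ (j + 3) * (a (j + 2) + d (j + 1))"
        using d2[of "j + 1"] by (simp add: numeral_3_eq_3)
      ultimately show ?thesis
        using dcoeff_1_1[of j] IH(4) 3 by (simp add: numeral_3_eq_3 mult_ac)
    qed
  qed
qed

text \<open>Only finitely many index pairs contribute to a given power of \<open>x\<close>, so its
  coefficient in a finite partial sum is constant once these pairs are included.\<close>

lemma has_sum_exponents:
  fixes c :: "nat \<Rightarrow> nat \<Rightarrow> 'a::comm_ring_1"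
  shows "((\<lambda>(m, n). fps_const (c m n) * fps_X ^ (2 * m + n)) has_sum
           Abs_fps (\<lambda>k. \<Sum>(m, n) | 2 * m + n = k. c m n)) UNIV"
  unfolding has_sum_def
proof (rule tendsto_fpsI)
  fix k :: nat
  let ?E = "{(m, n). 2 * m + n = k}"
  have "fps_nth (sum (\<lambda>(m, n). fps_const (c m n) * fps_X ^ (2 * m + n)) S) k = (\<Sum>(m, n)\<in>?E. c m n)"
    if "finite S" "?E \<subseteq> S" for S
  proof -
    have "fps_nth (sum (\<lambda>(m, n). fps_const (c m n) * fps_X ^ (2 * m + n)) S) k
        = (\<Sum>p\<in>S. if p \<in> ?E then (\<lambda>(m, n). c m n) p else 0)"
      unfolding fps_sum_nth by (intro sum.cong refl) (auto simp: fps_X_power_nth)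
    also have "\<dots> = (\<Sum>(m, n)\<in>?E. c m n)"
      using that by (intro sum.mono_neutral_cong_right) auto
    finally show ?thesis .
  qed
  then show "\<forall>\<^sub>F S in finite_subsets_at_top UNIV.
      fps_nth (sum (\<lambda>(m, n). fps_const (c m n) * fps_X ^ (2 * m + n)) S) k
        = fps_nth (Abs_fps (\<lambda>k. \<Sum>(m, n) | 2 * m + n = k. c m n)) k"
    unfolding eventually_finite_subsets_at_top
    by (intro exI[of _ ?E]) (auto simp: finite_exponents)
qed

section \<open>Pairs of sets\<close>

text \<open>The condition \<open>red_parts_matched\<close>, stated for the sets of red and blue
  parts.\<close>

definition matched :: "nat set \<Rightarrow> nat set \<Rightarrow> bool" where
  "matched R B \<longleftrightarrow> (\<exists>f. inj_on f R \<and> (\<forall>b\<in>R. (f b = b \<or> f b = b + 1) \<and> f b \<in> B))"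

lemma matched_image_Suc: "matched (Suc ` R) (Suc ` B) \<longleftrightarrow> matched R B"
proof
  assume "matched (Suc ` R) (Suc ` B)"
  then obtain f where f: "inj_on f (Suc ` R)"
      "\<forall>b\<in>Suc ` R. (f b = b \<or> f b = b + 1) \<and> f b \<in> Suc ` B"
    by (auto simp: matched_def)
  show "matched R B"
    unfolding matched_def
  proof (intro exI conjI ballI)
    \<comment> \<open>The values of \<open>f\<close> are successors, so subtracting 1 keeps distinct
      values distinct.\<close>
    show "inj_on (\<lambda>b. f (Suc b) - 1) R"
    proof (rule inj_onI)
      fix x y assume xy: "x \<in> R" "y \<in> R" and eq: "f (Suc x) - 1 = f (Suc y) - 1"
      have "f (Suc x) \<in> Suc ` B" "f (Suc y) \<in> Suc ` B" using f(2) xy by auto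
      with eq have "f (Suc x) = f (Suc y)" by auto
      with inj_onD[OF f(1) this] xy show "x = y" by auto
    qed
  qed (use f(2) in fastforce)+
next
  assume "matched R B"
  then obtain f where f: "inj_on f R" "\<forall>b\<in>R. (f b = b \<or> f b = b + 1) \<and> f b \<in> B"
    by (auto simp: matched_def)
  show "matched (Suc ` R) (Suc ` B)"
    unfolding matched_def
    by (rule exI[of _ "\<lambda>b. Suc (f (b - 1))"]) (use f in \<open>auto simp: inj_on_def\<close>)
qed

text \<open>All red parts are at least 2 and cannot use a blue 1.\<close>

lemma matched_insert_1_right:
  assumes "0 \<notin> R"
  shows "matched (Suc ` R) (insert 1 B) \<longleftrightarrow> matched (Suc ` R) B"
proof -
  have "f b \<in> insert 1 B \<longleftrightarrow> f b \<in> B" if "b \<in> Suc ` R" "f b = b \<or> f b = b + 1" for f b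
    using that assms by auto
  then show ?thesis unfolding matched_def by meson
qed

text \<open>The red 1 can always take the blue 1, for which no larger red part competes.\<close>

lemma matched_insert_1_both:
  assumes "0 \<notin> R"
  shows "matched (insert 1 (Suc ` R)) (insert 1 B) \<longleftrightarrow> matched (Suc ` R) B"
proof
  assume "matched (insert 1 (Suc ` R)) (insert 1 B)"
  then have "matched (Suc ` R) (insert 1 B)"
    unfolding matched_def by (meson inj_on_subset subset_insertI insertI2)
  then show "matched (Suc ` R) B"
    using assms matched_insert_1_right by blast
next
  assume "matched (Suc ` R) B"
  then obtain f where f: "inj_on f (Suc ` R)"
      "\<forall>b\<in>Suc ` R. (f b = b \<or> f b = b + 1) \<and> f b \<in> B"
    by (auto simp: matched_def)
  have "f b \<noteq> 1" if "b \<in> Suc ` R" for b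
    using f(2) that assms by fastforce
  moreover have "1 \<notin> Suc ` R" using assms by auto
  ultimately show "matched (insert 1 (Suc ` R)) (insert 1 B)"
    unfolding matched_def
    by (intro exI[of _ "f(1 := 1)"]) (use f in \<open>auto simp: inj_on_def\<close>)
qed

text \<open>Without a blue 1 the red 1 is forced to take the blue 2. After lowering, this is a blue
  1 closed to all other red parts, which is how the reserved pairs arise.\<close>

lemma matched_insert_1_left:
  assumes "0 \<notin> R" "0 \<notin> B"
  shows "matched (insert 1 (Suc ` R)) (Suc ` B) \<longleftrightarrow> 1 \<in> B \<and> matched R (B - {1})"
proof -
  have Diff: "Suc ` (B - {1}) = Suc ` B - {2}" by auto
  show ?thesis
  proof
    assume "matched (insert 1 (Suc ` R)) (Suc ` B)"
    then obtain f where f: "inj_on f (insert 1 (Suc ` R))"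
        "\<forall>b\<in>insert 1 (Suc ` R). (f b = b \<or> f b = b + 1) \<and> f b \<in> Suc ` B"
      by (auto simp: matched_def)
    have "f 1 \<noteq> 1" using f(2) assms(2) by fastforce
    then have f1: "f 1 = 2" using f(2) by auto
    then have "1 \<in> B" using f(2) by force
    moreover have "f b \<noteq> 2" if "b \<in> Suc ` R" for b
    proof
      assume "f b = 2"
      then have "b = 1" using inj_onD[OF f(1), of b 1] f1 that by auto
      then show False using that assms(1) by auto
    qed
    then have "matched (Suc ` R) (Suc ` (B - {1}))"
      unfolding matched_def Diff
      by (intro exI[of _ f]) (use f inj_on_subset[OF f(1)] in auto)
    ultimately show "1 \<in> B \<and> matched R (B - {1})"
      using matched_image_Suc by blast
  next
    assume "1 \<in> B \<and> matched R (B - {1})"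
    then have B: "1 \<in> B" and "matched (Suc ` R) (Suc ` (B - {1}))"
      using matched_image_Suc by blast+
    then obtain f where f: "inj_on f (Suc ` R)"
        "\<forall>b\<in>Suc ` R. (f b = b \<or> f b = b + 1) \<and> f b \<in> Suc ` B - {2}"
      unfolding Diff by (auto simp: matched_def)
    have "1 \<notin> Suc ` R" using assms(1) by auto
    moreover have "2 \<in> Suc ` B" using B by force
    ultimately show "matched (insert 1 (Suc ` R)) (Suc ` B)"
      unfolding matched_def
      by (intro exI[of _ "f(1 := 2)"]) (use f in \<open>auto simp: inj_on_def\<close>)
  qed
qed

section \<open>Removing the parts of size 1 and lowering the others\<close>

definition pos_pairs :: "(nat set \<times> nat set) set" where
  "pos_pairs = {(R, B). finite R \<and> finite B \<and> 0 \<notin> R \<and> 0 \<notin> B}"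

text \<open>Inverse to removing a possible part 1 and lowering the rest by 1; \<open>c\<close>
  records whether the part 1 was there.\<close>

definition add_one :: "bool \<Rightarrow> nat set \<Rightarrow> nat set" where
  "add_one c S = (if c then insert 1 (Suc ` S) else Suc ` S)"

definition add_ones :: "bool \<Rightarrow> bool \<Rightarrow> nat set \<times> nat set \<Rightarrow> nat set \<times> nat set" where
  "add_ones r b = map_prod (add_one r) (add_one b)"

definition pair_size :: "nat set \<times> nat set \<Rightarrow> nat" where
  "pair_size = (\<lambda>(R, B). card R + card B)"

definition pair_sum :: "nat set \<times> nat set \<Rightarrow> nat" where
  "pair_sum = (\<lambda>(R, B). \<Sum>R + \<Sum>B)"

lemma one_in_add_one: "0 \<notin> S \<Longrightarrow> 1 \<in> add_one c S \<longleftrightarrow> c"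
  by (auto simp: add_one_def)

lemma card_add_one: "finite S \<Longrightarrow> 0 \<notin> S \<Longrightarrow> card (add_one c S) = card S + of_bool c"
  by (simp add: add_one_def card_image image_iff)

text \<open>Each old part grows by 1 and a new part is itself 1, so every part of the result
  contributes 1. This is the source of the dilation of \<open>x\<close> to
  \<open>xq\<close>.\<close>

lemma sum_add_one:
  assumes "finite S" "0 \<notin> S"
  shows "\<Sum>(add_one c S) = \<Sum>S + card (add_one c S)"
proof -
  have "\<Sum>(Suc ` S) = (\<Sum>x\<in>S. x + 1)"
    by (subst sum.reindex) simp_all
  also have "\<dots> = \<Sum>S + card S"
    unfolding sum.distrib by simp
  finally show ?thesis
    unfolding card_add_one[OF assms] using assms by (simp add: add_one_def image_iff)
qed

lemma add_one_inject:
  assumes "0 \<notin> S" "0 \<notin> S'" "add_one c S = add_one c S'"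
  shows "S = S'"
proof -
  have "1 \<notin> Suc ` S" "1 \<notin> Suc ` S'" using assms by auto
  with assms(3) have "Suc ` S = Suc ` S'"
    by (metis add_one_def insert_ident)
  then show ?thesis by (simp add: inj_image_eq_iff)
qed

lemma add_one_cases:
  assumes "finite S" "0 \<notin> S"
  obtains S' where "finite S'" "0 \<notin> S'" "S = add_one (1 \<in> S) S'"
proof
  \<comment> \<open>Taking out 1 before lowering keeps 0 out of the preimage.\<close>
  let ?S' = "Suc -` (S - {1})"
  show "finite ?S'" using assms by (intro finite_vimageI) auto
  show "0 \<notin> ?S'" by simp
  have "x \<in> range Suc" if "x \<in> S" for x
    using that assms by (cases x) auto
  then have "Suc ` ?S' = S - {1}"
    unfolding image_vimage_eq by auto
  then show "S = add_one (1 \<in> S) ?S'"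
    by (auto simp: add_one_def)
qed

lemma add_ones_in_pos_pairs: "p \<in> pos_pairs \<Longrightarrow> add_ones r b p \<in> pos_pairs"
  by (auto simp: pos_pairs_def add_ones_def add_one_def split: if_splits)

lemma pos_pairs_cases:
  assumes "(R, B) \<in> pos_pairs"
  obtains R' B' where "(R', B') \<in> pos_pairs" "(R, B) = add_ones (1 \<in> R) (1 \<in> B) (R', B')"
proof -
  have fin: "finite R" "finite B" and pos: "0 \<notin> R" "0 \<notin> B"
    using assms by (auto simp: pos_pairs_def)
  obtain R' where "finite R'" "0 \<notin> R'" "R = add_one (1 \<in> R) R'"
    using add_one_cases[OF fin(1) pos(1)] .
  moreover obtain B' where "finite B'" "0 \<notin> B'" "B = add_one (1 \<in> B) B'"
    using add_one_cases[OF fin(2) pos(2)] .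
  ultimately show ?thesis
    by (intro that[of R' B']) (simp_all add: pos_pairs_def add_ones_def)
qed

lemma inj_on_add_ones: "inj_on (add_ones r b) pos_pairs"
proof (rule inj_onI)
  fix p p' assume "p \<in> pos_pairs" "p' \<in> pos_pairs" "add_ones r b p = add_ones r b p'"
  then show "p = p'"
    using add_one_inject[of "fst p" "fst p'" r] add_one_inject[of "snd p" "snd p'" b]
    by (cases p; cases p') (simp add: pos_pairs_def add_ones_def)
qed

lemma add_ones_ones:
  assumes "p \<in> pos_pairs"
  shows "1 \<in> fst (add_ones r b p) \<longleftrightarrow> r" "1 \<in> snd (add_ones r b p) \<longleftrightarrow> b"
  using assms one_in_add_one by (auto simp: pos_pairs_def add_ones_def)

lemma pair_size_add_ones:
  assumes "p \<in> pos_pairs"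
  shows "pair_size (add_ones r b p) = pair_size p + of_bool r + of_bool b"
  using assms by (auto simp: pos_pairs_def pair_size_def add_ones_def card_add_one)

lemma pair_sum_add_ones:
  assumes "p \<in> pos_pairs"
  shows "pair_sum (add_ones r b p) = pair_sum p + pair_size (add_ones r b p)"
  using assms by (auto simp: pos_pairs_def pair_sum_def pair_size_def add_ones_def sum_add_one)

definition matched_pairs :: "(nat set \<times> nat set) set" where
  "matched_pairs = {(R, B) \<in> pos_pairs. matched R B}"

text \<open>The blue part 1 is present but reserved, as if for a red part 0.\<close>

definition reserved_pairs :: "(nat set \<times> nat set) set" where
  "reserved_pairs = {(R, B) \<in> pos_pairs. 1 \<in> B \<and> matched R (B - {1})}"

lemma matched_pairs_subset: "matched_pairs \<subseteq> pos_pairs"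
  by (auto simp: matched_pairs_def)

lemma reserved_pairs_subset: "reserved_pairs \<subseteq> pos_pairs"
  by (auto simp: reserved_pairs_def)

text \<open>A blue 1 either serves the red 1 or nothing; only a red 1 without a blue 1 has to claim
  a raised blue part.\<close>

lemma matched_add_ones:
  assumes "p \<in> pos_pairs"
  shows "add_ones r b p \<in> matched_pairs \<longleftrightarrow> (if r \<and> \<not> b then p \<in> reserved_pairs else p \<in> matched_pairs)"
proof -
  obtain R B where p: "p = (R, B)" by (cases p)
  have "0 \<notin> R" "0 \<notin> B" using assms by (auto simp: p pos_pairs_def)
  then show ?thesis
    using assms add_ones_in_pos_pairs[OF assms, of r b]
    by (auto simp: p matched_pairs_def reserved_pairs_def add_ones_def add_one_def matched_image_Suc
        matched_insert_1_left[simplified] matched_insert_1_right[simplified]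
        matched_insert_1_both[simplified] split: if_splits)
qed

text \<open>With the reserved blue 1 set aside, only raised blue parts remain, so a red 1 must claim
  the blue 2 in turn.\<close>

lemma reserved_add_ones:
  assumes "p \<in> pos_pairs"
  shows "add_ones r b p \<in> reserved_pairs \<longleftrightarrow> b \<and> (if r then p \<in> reserved_pairs else p \<in> matched_pairs)"
proof -
  obtain R B where p: "p = (R, B)" by (cases p)
  have 0: "0 \<notin> R" "0 \<notin> B" using assms by (auto simp: p pos_pairs_def)
  then have Diff: "insert (Suc 0) (Suc ` B) - {Suc 0} = Suc ` B" by auto
  show ?thesis
    using assms add_ones_in_pos_pairs[OF assms, of r b] 0
    by (auto simp: p matched_pairs_def reserved_pairs_def add_ones_def add_one_def matched_image_Suc
        matched_insert_1_left[simplified] Diff split: if_splits)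
qed

section \<open>Counting series in \<open>q\<close> of the pairs with \<open>k\<close> parts\<close>

definition pair_count :: "(nat set \<times> nat set) set \<Rightarrow> nat \<Rightarrow> rat fps" where
  "pair_count S k = Abs_fps (\<lambda>n. of_nat (card {p \<in> S. pair_size p = k \<and> pair_sum p = n}))"

lemma finite_pairs_with_sum:
  assumes "S \<subseteq> pos_pairs"
  shows "finite {p \<in> S. pair_size p = k \<and> pair_sum p = n}"
proof (rule finite_subset)
  show "{p \<in> S. pair_size p = k \<and> pair_sum p = n} \<subseteq> Pow {..n} \<times> Pow {..n}"
  proof
    fix p assume p: "p \<in> {p \<in> S. pair_size p = k \<and> pair_sum p = n}"
    obtain R B where RB: "p = (R, B)" by (cases p)
    have fin: "finite R" "finite B" and n: "\<Sum>R + \<Sum>B = n"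
      using p assms by (auto simp: RB pos_pairs_def pair_sum_def)
    have "x \<le> n" if "x \<in> R" for x
      using member_le_sum[of x R "\<lambda>x. x"] that fin n by simp
    moreover have "x \<le> n" if "x \<in> B" for x
      using member_le_sum[of x B "\<lambda>x. x"] that fin n by simp
    ultimately show "p \<in> Pow {..n} \<times> Pow {..n}" by (auto simp: RB)
  qed
qed simp

lemma pair_count_Un:
  assumes "S \<subseteq> pos_pairs" "T \<subseteq> pos_pairs" "S \<inter> T = {}"
  shows "pair_count (S \<union> T) k = pair_count S k + pair_count T k"
proof (rule fps_ext)
  fix n
  let ?P = "\<lambda>S. {p \<in> S. pair_size p = k \<and> pair_sum p = n}"
  have "?P (S \<union> T) = ?P S \<union> ?P T" by auto
  moreover have "card (?P S \<union> ?P T) = card (?P S) + card (?P T)"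
    by (rule card_Un_disjoint) (use assms finite_pairs_with_sum in auto)
  ultimately show "fps_nth (pair_count (S \<union> T) k) n = fps_nth (pair_count S k + pair_count T k) n"
    by (simp add: pair_count_def)
qed

text \<open>With \<open>j = of_bool r + of_bool b\<close> added ones, this is the passage from a
  series \<open>S(x)\<close> to \<open>x ^ j q ^ j S(xq)\<close>.\<close>

lemma pair_count_add_ones:
  assumes "S \<subseteq> pos_pairs"
  shows "pair_count (add_ones r b ` S) (k + of_bool r + of_bool b)
    = fps_X ^ (k + of_bool r + of_bool b) * pair_count S k"
proof (rule fps_ext)
  fix n
  define l where "l = k + of_bool r + of_bool b"
  have "{p \<in> add_ones r b ` S. pair_size p = l \<and> pair_sum p = n}
      = add_ones r b ` {p \<in> S. pair_size p = k \<and> pair_sum p + l = n}"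
    using assms pair_size_add_ones pair_sum_add_ones by (fastforce simp: l_def)
  moreover have "inj_on (add_ones r b) {p \<in> S. pair_size p = k \<and> pair_sum p + l = n}"
    by (rule inj_on_subset[OF inj_on_add_ones]) (use assms in auto)
  ultimately have "card {p \<in> add_ones r b ` S. pair_size p = l \<and> pair_sum p = n}
      = card {p \<in> S. pair_size p = k \<and> pair_sum p + l = n}"
    by (simp add: card_image)
  also have "{p \<in> S. pair_size p = k \<and> pair_sum p + l = n}
      = (if n < l then {} else {p \<in> S. pair_size p = k \<and> pair_sum p = n - l})"
    by auto
  finally show "fps_nth (pair_count (add_ones r b ` S) (k + of_bool r + of_bool b)) n
      = fps_nth (fps_X ^ (k + of_bool r + of_bool b) * pair_count S k) n"
    by (simp add: pair_count_def fps_X_power_mult_nth flip: l_def)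
qed

text \<open>Covers the low degrees, where there are fewer parts than added ones.\<close>

lemma pair_count_add_ones_small:
  assumes "S \<subseteq> pos_pairs" "k < of_bool r + of_bool b"
  shows "pair_count (add_ones r b ` S) k = 0"
proof -
  have "pair_size p \<noteq> k" if "p \<in> add_ones r b ` S" for p
    using that assms pair_size_add_ones by fastforce
  then have *: "{p \<in> add_ones r b ` S. pair_size p = k \<and> pair_sum p = n} = {}" for n
    by blast
  show ?thesis unfolding pair_count_def * by (simp add: fps_zero_def)
qed

text \<open>The pairs counted by \<open>t2\<close>, with series \<open>E\<close>.\<close>

definition unpaired_one_pairs :: "(nat set \<times> nat set) set" where
  "unpaired_one_pairs = {(R, B) \<in> matched_pairs. \<not> (1 \<in> R \<and> 1 \<in> B)}"

text \<open>The three admissible choices of ones give the three summands of the equation for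
  \<open>E\<close>.\<close>

lemma unpaired_one_pairs_decomp:
  "unpaired_one_pairs = add_ones False False ` matched_pairs \<union> add_ones False True ` matched_pairs
     \<union> add_ones True False ` reserved_pairs" (is "?L = ?R")
proof (intro equalityI subsetI)
  fix p assume p: "p \<in> ?L"
  obtain R B where RB: "p = (R, B)" by (cases p)
  have "(R, B) \<in> pos_pairs" using p by (auto simp: RB unpaired_one_pairs_def matched_pairs_def)
  then obtain R' B' where *: "(R', B') \<in> pos_pairs" "(R, B) = add_ones (1 \<in> R) (1 \<in> B) (R', B')"
    by (rule pos_pairs_cases)
  have "add_ones (1 \<in> R) (1 \<in> B) (R', B') \<in> matched_pairs" "\<not> (1 \<in> R \<and> 1 \<in> B)"
    using p * by (auto simp: RB unpaired_one_pairs_def)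
  then show "p \<in> ?R"
    using * unfolding RB matched_add_ones[OF *(1)]
    by (cases "1 \<in> R"; cases "1 \<in> B") auto
next
  have *: "add_ones r b p \<in> unpaired_one_pairs \<longleftrightarrow> \<not> (r \<and> b) \<and> add_ones r b p \<in> matched_pairs"
    if "p \<in> pos_pairs" for r b p
    using add_ones_ones[OF that, of r b] by (auto simp: unpaired_one_pairs_def case_prod_unfold)
  fix p assume "p \<in> ?R"
  then show "p \<in> ?L"
    using matched_pairs_subset reserved_pairs_subset by (auto simp: * matched_add_ones subset_iff)
qed

text \<open>The remaining choice, both ones, gives the summand \<open>x^2 q^2 A(xq)\<close> in the
  equation for \<open>A\<close>.\<close>

lemma matched_pairs_decomp: "matched_pairs = unpaired_one_pairs \<union> add_ones True True ` matched_pairs"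
proof (intro equalityI subsetI)
  fix p assume p: "p \<in> matched_pairs"
  obtain R B where RB: "p = (R, B)" by (cases p)
  have "(R, B) \<in> pos_pairs" using p by (auto simp: RB matched_pairs_def)
  then obtain R' B' where *: "(R', B') \<in> pos_pairs" "(R, B) = add_ones (1 \<in> R) (1 \<in> B) (R', B')"
    by (rule pos_pairs_cases)
  have "add_ones (1 \<in> R) (1 \<in> B) (R', B') \<in> matched_pairs"
    using p * by (auto simp: RB)
  then show "p \<in> unpaired_one_pairs \<union> add_ones True True ` matched_pairs"
    using * p unfolding RB matched_add_ones[OF *(1)]
    by (cases "1 \<in> R"; cases "1 \<in> B") (auto simp: unpaired_one_pairs_def)
next
  fix p assume "p \<in> unpaired_one_pairs \<union> add_ones True True ` matched_pairs"
  then show "p \<in> matched_pairs"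
    using matched_pairs_subset by (auto simp: unpaired_one_pairs_def matched_add_ones subset_iff)
qed

text \<open>The blue 1 is compulsory, so only the red 1 is optional; this is the equation for
  \<open>D\<close>.\<close>

lemma reserved_pairs_decomp:
  "reserved_pairs = add_ones False True ` matched_pairs \<union> add_ones True True ` reserved_pairs"
proof (intro equalityI subsetI)
  fix p assume p: "p \<in> reserved_pairs"
  obtain R B where RB: "p = (R, B)" by (cases p)
  have "(R, B) \<in> pos_pairs" using p by (auto simp: RB reserved_pairs_def)
  then obtain R' B' where *: "(R', B') \<in> pos_pairs" "(R, B) = add_ones (1 \<in> R) (1 \<in> B) (R', B')"
    by (rule pos_pairs_cases)
  have "add_ones (1 \<in> R) (1 \<in> B) (R', B') \<in> reserved_pairs"
    using p * by (auto simp: RB)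
  then show "p \<in> add_ones False True ` matched_pairs \<union> add_ones True True ` reserved_pairs"
    using * p unfolding RB reserved_add_ones[OF *(1)]
    by (cases "1 \<in> R"; cases "1 \<in> B") auto
next
  fix p assume "p \<in> add_ones False True ` matched_pairs \<union> add_ones True True ` reserved_pairs"
  then show "p \<in> reserved_pairs"
    using matched_pairs_subset reserved_pairs_subset by (auto simp: reserved_add_ones subset_iff)
qed

lemma add_ones_image_subset: "S \<subseteq> pos_pairs \<Longrightarrow> add_ones r b ` S \<subseteq> pos_pairs"
  using add_ones_in_pos_pairs by blast

text \<open>The flags \<open>r\<close> and \<open>b\<close> can be read off from the ones in the
  resulting pair.\<close>

lemma add_ones_image_disjoint:
  assumes "S \<subseteq> pos_pairs" "T \<subseteq> pos_pairs" "(r, b) \<noteq> (r', b')"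
  shows "add_ones r b ` S \<inter> add_ones r' b' ` T = {}"
proof -
  have False if "p \<in> S" "p' \<in> T" "add_ones r b p = add_ones r' b' p'" for p p'
    using that assms add_ones_ones[of p r b] add_ones_ones[of p' r' b'] by auto
  then show ?thesis by blast
qed

lemma pair_count_unpaired:
  "pair_count unpaired_one_pairs k = pair_count (add_ones False False ` matched_pairs) k
     + pair_count (add_ones False True ` matched_pairs) k + pair_count (add_ones True False ` reserved_pairs) k"
  unfolding unpaired_one_pairs_decomp
  by (simp add: pair_count_Un add_ones_image_subset add_ones_image_disjoint
      matched_pairs_subset reserved_pairs_subset Int_Un_distrib2)

lemma pair_count_matched:
  "pair_count matched_pairs k = pair_count unpaired_one_pairs k + pair_count (add_ones True True ` matched_pairs) k"
proof -
  have "unpaired_one_pairs \<inter> add_ones True True ` matched_pairs = {}"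
    unfolding unpaired_one_pairs_decomp
    by (simp add: add_ones_image_disjoint matched_pairs_subset reserved_pairs_subset Int_Un_distrib2)
  moreover have "unpaired_one_pairs \<subseteq> pos_pairs"
    using matched_pairs_subset by (auto simp: unpaired_one_pairs_def)
  ultimately show ?thesis
    by (subst matched_pairs_decomp)
      (simp add: pair_count_Un add_ones_image_subset matched_pairs_subset)
qed

lemma pair_count_reserved:
  "pair_count reserved_pairs k = pair_count (add_ones False True ` matched_pairs) k
     + pair_count (add_ones True True ` reserved_pairs) k"
  by (subst reserved_pairs_decomp)
    (simp add: pair_count_Un add_ones_image_subset add_ones_image_disjoint
      matched_pairs_subset reserved_pairs_subset)

lemma pair_count_matched_0: "pair_count matched_pairs 0 = 1"
proof -
  have "{p \<in> matched_pairs. pair_size p = 0 \<and> pair_sum p = n} = (if n = 0 then {({}, {})} else {})" for n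
    by (auto simp: matched_pairs_def pos_pairs_def pair_size_def pair_sum_def matched_def)
  then show ?thesis
    by (intro fps_ext) (simp add: pair_count_def)
qed

section \<open>From pairs of sets to bicolored partitions\<close>

definition pair_mset :: "nat set \<times> nat set \<Rightarrow> (nat \<times> color) multiset" where
  "pair_mset = (\<lambda>(R, B). mset_set (R \<times> {Red} \<union> B \<times> {Blue}))"

lemma parts_of_color_pair_mset:
  assumes "(R, B) \<in> pos_pairs"
  shows "parts_of_color Red (pair_mset (R, B)) = R" "parts_of_color Blue (pair_mset (R, B)) = B"
  using assms by (auto simp: parts_of_color_def pair_mset_def pos_pairs_def)

lemma pair_mset_bicolored:
  assumes "p \<in> pos_pairs"
  shows "pair_mset p \<in> bicolored_partitions m n \<longleftrightarrow> pair_size p = m \<and> pair_sum p = n"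
proof -
  obtain R B where p: "p = (R, B)" by (cases p)
  have fin: "finite R" "finite B" and pos: "0 \<notin> R" "0 \<notin> B"
    using assms by (auto simp: p pos_pairs_def)
  have "size (pair_mset p) = pair_size p"
    using fin by (simp add: p pair_mset_def pair_size_def card_Un_disjoint disjoint_iff)
  moreover have "(\<Sum>x\<in>#pair_mset p. fst x) = (\<Sum>x\<in>R \<times> {Red} \<union> B \<times> {Blue}. fst x)"
    by (simp add: p pair_mset_def sum_unfold_sum_mset)
  moreover have "\<dots> = (\<Sum>x\<in>R \<times> {Red}. fst x) + (\<Sum>x\<in>B \<times> {Blue}. fst x)"
    using fin by (intro sum.union_disjoint) auto
  moreover have "\<dots> = pair_sum p"
    by (simp add: p pair_sum_def sum.cartesian_product')
  moreover have "\<forall>x\<in>#pair_mset p. 0 < fst x"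
    using fin pos by (auto simp: p pair_mset_def intro: gr0I)
  ultimately show ?thesis by (simp add: bicolored_partitions_def)
qed

lemma pair_mset_no_repeated_parts: "no_repeated_parts (pair_mset p)"
  by (simp add: no_repeated_parts_def pair_mset_def case_prod_unfold count_mset_set')

text \<open>A multiset with multiplicities at most 1 is determined by its underlying set, which
  splits by color.\<close>

lemma no_repeated_partsE:
  assumes "no_repeated_parts P" "P \<in> bicolored_partitions m n"
  obtains p where "p \<in> pos_pairs" "P = pair_mset p"
proof
  let ?p = "(parts_of_color Red P, parts_of_color Blue P)"
  have eq: "parts_of_color Red P \<times> {Red} \<union> parts_of_color Blue P \<times> {Blue} = set_mset P"
    by (auto simp: parts_of_color_def) (metis color.exhaust)+
  have "finite (parts_of_color c P)" for c
  proof -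
    have "parts_of_color c P \<subseteq> fst ` set_mset P"
      by (force simp: parts_of_color_def)
    then show ?thesis by (rule finite_subset) simp
  qed
  moreover have "0 \<notin> parts_of_color c P" for c
    using assms(2) by (force simp: parts_of_color_def bicolored_partitions_def)
  ultimately show "?p \<in> pos_pairs" by (simp add: pos_pairs_def)
  show "P = pair_mset ?p"
    unfolding pair_mset_def prod.case eq
  proof (rule multiset_eqI)
    fix x
    have "count P x \<le> 1" using assms(1) unfolding no_repeated_parts_def by blast
    then show "count P x = count (mset_set (set_mset P)) x"
      by (cases "x \<in># P") (auto simp: count_mset_set' not_in_iff simp flip: count_greater_zero_iff)
  qed
qed

lemma T1_eq: "T1 m n = pair_mset ` {p \<in> matched_pairs. pair_size p = m \<and> pair_sum p = n}"
proof -
  have *: "pair_mset p \<in> T1 m n \<longleftrightarrow> p \<in> matched_pairs \<and> pair_size p = m \<and> pair_sum p = n"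
    if "p \<in> pos_pairs" for p
    using that by (cases p)
      (auto simp: T1_def pair_mset_bicolored pair_mset_no_repeated_parts matched_pairs_def
        red_parts_matched_def matched_def parts_of_color_pair_mset)
  show ?thesis
  proof (intro equalityI subsetI)
    fix P assume P: "P \<in> T1 m n"
    then obtain p where "p \<in> pos_pairs" "P = pair_mset p"
      using no_repeated_partsE unfolding T1_def by blast
    then show "P \<in> pair_mset ` {p \<in> matched_pairs. pair_size p = m \<and> pair_sum p = n}"
      using P * by auto
  qed (use * matched_pairs_subset in auto)
qed

lemma T2_eq: "T2 m n = pair_mset ` {p \<in> unpaired_one_pairs. pair_size p = m \<and> pair_sum p = n}"
proof -
  have "(1, Red) \<in># pair_mset p \<and> (1, Blue) \<in># pair_mset p \<longleftrightarrow> 1 \<in> fst p \<and> 1 \<in> snd p"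
    if "p \<in> pos_pairs" for p
    using that by (auto simp: pair_mset_def pos_pairs_def case_prod_unfold)
  then show ?thesis
    unfolding T2_def T1_eq unpaired_one_pairs_def using matched_pairs_subset by fastforce
qed

lemma inj_on_pair_mset: "inj_on pair_mset pos_pairs"
  proof (rule inj_onI)
  fix p p' assume pos: "p \<in> pos_pairs" "p' \<in> pos_pairs" and eq: "pair_mset p = pair_mset p'"
  show "p = p'"
    using parts_of_color_pair_mset[of "fst p" "snd p"] parts_of_color_pair_mset[of "fst p'" "snd p'"] pos eq
    by (simp add: prod_eq_iff)
qed

section \<open>Identification of the counting series with the double series\<close>

lemma gen_fun_t1: "gen_fun t1 = Abs_fps (pair_count matched_pairs)"
proof -
  have "t1 m n = card {p \<in> matched_pairs. pair_size p = m \<and> pair_sum p = n}" for m n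
    unfolding t1_def T1_eq
    by (intro card_image inj_on_subset[OF inj_on_pair_mset]) (use matched_pairs_subset in auto)
  then show ?thesis by (simp add: gen_fun_def pair_count_def[abs_def])
qed

lemma gen_fun_t2: "gen_fun t2 = Abs_fps (pair_count unpaired_one_pairs)"
proof -
  have "t2 m n = card {p \<in> unpaired_one_pairs. pair_size p = m \<and> pair_sum p = n}" for m n
    unfolding t2_def T2_eq
    by (intro card_image inj_on_subset[OF inj_on_pair_mset])
      (use matched_pairs_subset in \<open>auto simp: unpaired_one_pairs_def\<close>)
  then show ?thesis by (simp add: gen_fun_def pair_count_def[abs_def])
qed

text \<open>Inserting the equation for \<open>E\<close> into that for \<open>A\<close> leaves
  recurrences in \<open>A\<close> and \<open>D\<close> alone, as \<open>recurrence_unique\<close>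
  requires.\<close>

lemma pair_count_matched_dcoeff:
  "pair_count matched_pairs k = dcoeff 0 0 k \<and> pair_count reserved_pairs (k + 1) = q * dcoeff 1 1 k"
proof (rule recurrence_unique)
  note subsets = matched_pairs_subset reserved_pairs_subset
  let ?a = "pair_count matched_pairs" and ?d = "pair_count reserved_pairs"
  show "?a 0 = 1" by (rule pair_count_matched_0)
  show "?d 0 = 0"
    unfolding pair_count_reserved by (simp add: pair_count_add_ones_small subsets)
  \<comment> \<open>A single part cannot provide both ones, so that case contributes 0.\<close>
  show "?a 1 = q * (?a 1 + ?a 0 + ?d 0)"
    using pair_count_add_ones[OF subsets(1), of False False 1]
      pair_count_add_ones[OF subsets(1), of False True 0]
      pair_count_add_ones[OF subsets(2), of True False 0]
    by (subst pair_count_matched, subst pair_count_unpaired) (simp add: pair_count_add_ones_small subsets algebra_simps flip: q_def)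
  show "?d 1 = q * ?a 0"
    unfolding pair_count_reserved[of 1]
    using pair_count_add_ones[OF subsets(1), of False True 0]
    by (simp add: pair_count_add_ones_small subsets flip: q_def)
  fix k
  show "?a (k + 2) = q ^ (k + 2) * (?a (k + 2) + ?a (k + 1) + ?a k + ?d (k + 1))"
    using pair_count_add_ones[OF subsets(1), of False False "k + 2"]
      pair_count_add_ones[OF subsets(1), of False True "k + 1"]
      pair_count_add_ones[OF subsets(2), of True False "k + 1"]
      pair_count_add_ones[OF subsets(1), of True True k]
    by (subst pair_count_matched, subst pair_count_unpaired) (simp add: algebra_simps flip: q_def)
  show "?d (k + 2) = q ^ (k + 2) * (?a (k + 1) + ?d k)"
    unfolding pair_count_reserved[of "k + 2"]
    using pair_count_add_ones[OF subsets(1), of False True "k + 1"]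
      pair_count_add_ones[OF subsets(2), of True True k]
    by (simp add: algebra_simps flip: q_def)
qed

text \<open>On both sides \<open>E = A - x^2 q^2 A(xq)\<close>, so agreement for \<open>A\<close>
  suffices; the subtracted term vanishes in degrees 0 and 1.\<close>

lemma pair_count_unpaired_dcoeff: "pair_count unpaired_one_pairs k = dcoeff 1 0 k"
proof -
  have a: "pair_count matched_pairs k = dcoeff 0 0 k" for k
    using pair_count_matched_dcoeff by blast
  consider "k = 0" | "k = 1" | j where "k = j + 2"
    by (metis One_nat_def add_2_eq_Suc' not0_implies_Suc)
  then show ?thesis
  proof cases
    case 1
    then show ?thesis
      using pair_count_matched[of 0] a[of 0]
      by (simp add: pair_count_add_ones_small matched_pairs_subset dcoeff_0)
  next
    case 2
    then show ?thesis
      using pair_count_matched[of 1] a[of 1] dcoeff_1[of 1 0]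
      by (simp add: pair_count_add_ones_small matched_pairs_subset)
  next
    case 3
    then show ?thesis
      using pair_count_matched[of k] a[of k] a[of j] dcoeff_0_0[of j]
        pair_count_add_ones[OF matched_pairs_subset, of True True j]
      by (simp add: q_def)
  qed
qed

theorem theorem5:
  shows "((\<lambda>(m, n).
            fps_const
              (fps_X ^ (2 * ((m + 1) choose 2) + ((n + 1) choose 2) + m * n)
                 / (qpoch fps_X fps_X m * qpoch fps_X fps_X n) :: rat fps)
            * fps_X ^ (2 * m + n))
          has_sum gen_fun t1) (UNIV :: (nat \<times> nat) set)
       \<and> ((\<lambda>(m, n).
            fps_const
              (fps_X ^ (2 * ((m + 1) choose 2) + ((n + 1) choose 2) + m * n + m)
                 / (qpoch fps_X fps_X m * qpoch fps_X fps_X n) :: rat fps)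
            * fps_X ^ (2 * m + n))
          has_sum gen_fun t2) (UNIV :: (nat \<times> nat) set)"
proof
  \<comment> \<open>Both double series are grouped by the exponent of \<open>x\<close>; the extra
    exponent \<open>m\<close> in the second one corresponds to \<open>a = 1\<close>,
    \<open>b = 0\<close>.\<close>
  have 1: "gen_fun t1 = Abs_fps (\<lambda>k. \<Sum>(m, n) | 2 * m + n = k. dterm 0 0 m n)"
    unfolding gen_fun_t1 dcoeff_def[symmetric] using pair_count_matched_dcoeff by presburger
  have 2: "gen_fun t2 = Abs_fps (\<lambda>k. \<Sum>(m, n) | 2 * m + n = k. dterm 1 0 m n)"
    unfolding gen_fun_t2 dcoeff_def[symmetric] pair_count_unpaired_dcoeff[abs_def] ..
  show "((\<lambda>(m, n).
            fps_const
              (fps_X ^ (2 * ((m + 1) choose 2) + ((n + 1) choose 2) + m * n)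
                 / (qpoch fps_X fps_X m * qpoch fps_X fps_X n) :: rat fps)
            * fps_X ^ (2 * m + n))
          has_sum gen_fun t1) UNIV"
    using has_sum_exponents[of "dterm 0 0", folded 1]
    unfolding dterm_def q_def mult_zero_left add_0_right .
  show "((\<lambda>(m, n).
            fps_const
              (fps_X ^ (2 * ((m + 1) choose 2) + ((n + 1) choose 2) + m * n + m)
                 / (qpoch fps_X fps_X m * qpoch fps_X fps_X n) :: rat fps)
            * fps_X ^ (2 * m + n))
          has_sum gen_fun t2) UNIV"
    using has_sum_exponents[of "dterm 1 0", folded 2]
    unfolding dterm_def q_def mult_zero_left mult_1_left add_0_right .
qed

end
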